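(* The operad $\mathsf{C}\mathbb{D}_0$ is isomorphic to the suboperad of $\mathsf{MT}$ consisting in the linear span of all multi-tildes except the nontrivial multi-tilde $(1,\{(1,1)\})$ of arity $1$. Moreover, $\phi_{\mathsf{MT}}$ is an isomorphism between these two operads (from the said suboperad of $\mathsf{MT}$ to $\mathsf{C}\mathbb{D}_0$).
   Context: Let $\mathbb{K}$ be a field of characteristic zero and $[n]=\{1,\dots,n\}$. Operads are nonsymmetric operads in $\mathbb{K}$-vector spaces (graded from arity $1$, with partial compositions $\circ_i$ and a unit of arity $1$); operad morphisms are linear maps that respect arities, units and partial compositions. $\mathbb{D}_0=\{\mathbb{1},0\}$ is the unitary magma with unit $\mathbb{1}$ and absorbing element $0$ (so $0\star0=0$). For a unitary magma $\mathcal{M}$ with operation $\star$ and unit $\mathbb{1}_{\mathcal{M}}$, an $\mathcal{M}$-clique of arity $n\ge1$ is a map $\mathfrak{p}$ assigning a label $\mathfrak{p}(x,y)\in\mathcal{M}$ to each arc $(x,y)$, $1\le x<y\le n+1$; by convention the only $\mathcal{M}$-clique of arity $1$ is $\mathbf{u}$, with $\mathbf{u}(1,2)=\mathbb{1}_{\mathcal{M}}$. Write $\mathfrak{p}_0:=\mathfrak{p}(1,n+1)$ and $\mathfrak{p}_i:=\mathfrak{p}(i,i+1)$ for $i\in[n]$. $\mathsf{C}\mathcal{M}$ is the operad (with unit $\mathbf{u}$) such that $\mathsf{C}\mathcal{M}(n)$ has basis the $\mathcal{M}$-cliques of arity $n$, and for $\mathcal{M}$-cliques $\mathfrak{p},\mathfrak{q}$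 of arities $n,m$ and $i\in[n]$, $\mathfrak{p}\circ_i\mathfrak{q}$ is the $\mathcal{M}$-clique of arity $n+m-1$ with, for $1\le x<y\le n+m$, $$(\mathfrak{p}\circ_i\mathfrak{q})(x,y)=\begin{cases}\mathfrak{p}(x,y)&\text{if }y\le i,\\ \mathfrak{p}(x,y-m+1)&\text{if }x\le i<i+m\le y,\ (x,y)\ne(i,i+m),\\ \mathfrak{p}(x-m+1,y-m+1)&\text{if }i+m\le x,\\ \mathfrak{q}(x-i+1,y-i+1)&\text{if }i\le x<y\le i+m,\ (x,y)\ne(i,i+m),\\ \mathfrak{p}_i\star\mathfrak{q}_0&\text{if }(x,y)=(i,i+m),\\ \mathbb{1}_{\mathcal{M}}&\text{otherwise}.\end{cases}$$ A multi-tilde of arity $n\ge1$ is a pair $(n,\mathfrak{s})$ with $\mathfrak{s}\subseteq P_n:=\{(x,y)\in[n]^2:x\le y\}$. The operad $\mathsf{MT}$ is the linear span of all multi-tildes, graded by arity, with unit $(1,\emptyset)$ and, for $i\in[n]$, $$(n,\mathfrak{s})\circ_i(m,\mathfrak{t})=\bigl(n+m-1,\ \{\mathrm{sh}_i^m(x,y):(x,y)\in\mathfrak{s}\}\cup\{\mathrm{sh}_0^i(x,y):(x,y)\in\mathfrak{t}\}\bigr),$$ where $\mathrm{sh}_j^p(x,y)=(x,y)$ if $y\le j-1$, $\mathrm{sh}_j^p(x,y)=(x,y+p-1)$ if $x\le j\le y$, and $\mathrm{sh}_j^p(x,y)=(x+p-1,y+p-1)$ otherwise. $\phi_{\mathsf{MT}}$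 is the linear map sending each multi-tilde $(n,\mathfrak{s})\ne(1,\{(1,1)\})$ to the $\mathbb{D}_0$-clique of arity $n$ defined, for $1\le x<y\le n+1$, by $\phi_{\mathsf{MT}}((n,\mathfrak{s}))(x,y)=0$ if $(x,y-1)\in\mathfrak{s}$ and $\mathbb{1}$ otherwise. *)

theory Defs
  imports Complex_Main "HOL-Library.Poly_Mapping" "HOL-Library.FuncSet"
begin

section \<open>Nonsymmetric operads in vector spaces\<close>

text \<open>
  The space of the operad is presented inside an ambient vector space on the type \<open>'v\<close>:
  \<open>component P n\<close> is the homogeneous component of arity \<open>n\<close>, for \<open>n \<ge> 1\<close> (nothing is said about
  \<open>component P 0\<close>), and \<open>pcomp P i x y\<close> is the partial composition of \<open>x\<close> and \<open>y\<close> at position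
  \<open>i\<close>, meaningful only if \<open>x\<close> is homogeneous of arity at least \<open>i \<ge> 1\<close> and \<open>y\<close> is homogeneous.
\<close>

record ('k, 'v) operad_data =
  scale :: "'k \<Rightarrow> 'v \<Rightarrow> 'v"
  component :: "nat \<Rightarrow> 'v set"
  pcomp :: "nat \<Rightarrow> 'v \<Rightarrow> 'v \<Rightarrow> 'v"
  op_unit :: "'v"

locale ns_operad = vector_space "scale P"
  for P :: "('k::field, 'v::ab_group_add) operad_data" +
  assumes component_subspace: "n \<ge> 1 \<Longrightarrow> module.subspace (scale P) (component P n)"
    and components_independent:
      "\<lbrakk>finite N; N \<subseteq> {1..}; \<And>n. n \<in> N \<Longrightarrow> v n \<in> component P n; (\<Sum>n\<in>N. v n) = 0; m \<in> N\<rbrakk>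
        \<Longrightarrow> v m = 0"
    and unit_closed: "op_unit P \<in> component P 1"
    and pcomp_closed:
      "\<lbrakk>n \<ge> 1; m \<ge> 1; i \<in> {1..n}; x \<in> component P n; y \<in> component P m\<rbrakk>
        \<Longrightarrow> pcomp P i x y \<in> component P (n + m - 1)"
    and pcomp_add_left:
      "\<lbrakk>n \<ge> 1; m \<ge> 1; i \<in> {1..n}; x \<in> component P n; x' \<in> component P n; y \<in> component P m\<rbrakk>
        \<Longrightarrow> pcomp P i (x + x') y = pcomp P i x y + pcomp P i x' y"
    and pcomp_scale_left:
      "\<lbrakk>n \<ge> 1; m \<ge> 1; i \<in> {1..n}; x \<in> component P n; y \<in> component P m\<rbrakk>
        \<Longrightarrow> pcomp P i (scale P c x) y = scale P c (pcomp P i x y)"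
    and pcomp_add_right:
      "\<lbrakk>n \<ge> 1; m \<ge> 1; i \<in> {1..n}; x \<in> component P n; y \<in> component P m; y' \<in> component P m\<rbrakk>
        \<Longrightarrow> pcomp P i x (y + y') = pcomp P i x y + pcomp P i x y'"
    and pcomp_scale_right:
      "\<lbrakk>n \<ge> 1; m \<ge> 1; i \<in> {1..n}; x \<in> component P n; y \<in> component P m\<rbrakk>
        \<Longrightarrow> pcomp P i x (scale P c y) = scale P c (pcomp P i x y)"
    and pcomp_assoc_sequential:
      "\<lbrakk>n \<ge> 1; m \<ge> 1; l \<ge> 1; i \<in> {1..n}; j \<in> {1..m};
        x \<in> component P n; y \<in> component P m; z \<in> component P l\<rbrakk>
        \<Longrightarrow> pcomp P (i + j - 1) (pcomp P i x y) z = pcomp P i x (pcomp P j y z)"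
    and pcomp_assoc_parallel:
      "\<lbrakk>n \<ge> 1; m \<ge> 1; l \<ge> 1; 1 \<le> i; i < j; j \<le> n;
        x \<in> component P n; y \<in> component P m; z \<in> component P l\<rbrakk>
        \<Longrightarrow> pcomp P (j + m - 1) (pcomp P i x y) z = pcomp P i (pcomp P j x z) y"
    and pcomp_unit_left: "\<lbrakk>n \<ge> 1; x \<in> component P n\<rbrakk> \<Longrightarrow> pcomp P 1 (op_unit P) x = x"
    and pcomp_unit_right: "\<lbrakk>n \<ge> 1; i \<in> {1..n}; x \<in> component P n\<rbrakk> \<Longrightarrow> pcomp P i x (op_unit P) = x"

definition suboperad ::
  "('k::field, 'v::ab_group_add) operad_data \<Rightarrow> ('k, 'v) operad_data \<Rightarrow> bool"
  where "suboperad S P \<longleftrightarrow>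
    ns_operad P \<and> ns_operad S \<and>
    scale S = scale P \<and> pcomp S = pcomp P \<and> op_unit S = op_unit P \<and>
    (\<forall>n\<ge>1. component S n \<subseteq> component P n)"

definition operad_hom ::
  "('k::field, 'v::ab_group_add) operad_data \<Rightarrow> ('k, 'w::ab_group_add) operad_data \<Rightarrow> ('v \<Rightarrow> 'w) \<Rightarrow> bool"
  where "operad_hom P Q f \<longleftrightarrow>
    ns_operad P \<and> ns_operad Q \<and>
    (\<forall>n\<ge>1. \<forall>x\<in>component P n. f x \<in> component Q n) \<and>
    (\<forall>n\<ge>1. \<forall>x\<in>component P n. \<forall>y\<in>component P n. f (x + y) = f x + f y) \<and>
    (\<forall>n\<ge>1. \<forall>c. \<forall>x\<in>component P n. f (scale P c x) = scale Q c (f x)) \<and>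
    f (op_unit P) = op_unit Q \<and>
    (\<forall>n\<ge>1. \<forall>m\<ge>1. \<forall>i\<in>{1..n}. \<forall>x\<in>component P n. \<forall>y\<in>component P m.
       f (pcomp P i x y) = pcomp Q i (f x) (f y))"

definition operad_iso ::
  "('k::field, 'v::ab_group_add) operad_data \<Rightarrow> ('k, 'w::ab_group_add) operad_data \<Rightarrow> ('v \<Rightarrow> 'w) \<Rightarrow> bool"
  where "operad_iso P Q f \<longleftrightarrow>
    operad_hom P Q f \<and> (\<forall>n\<ge>1. bij_betw f (component P n) (component Q n))"

definition operad_isomorphic ::
  "('k::field, 'v::ab_group_add) operad_data \<Rightarrow> ('k, 'w::ab_group_add) operad_data \<Rightarrow> bool"
  where "operad_isomorphic P Q \<longleftrightarrow> (\<exists>f. operad_iso P Q f)"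


section \<open>Free vector spaces\<close>

text \<open>The free vector space on a type \<open>'a\<close> is the type of finitely supported functions on \<open>'a\<close>.\<close>

definition free_scale :: "'k::field \<Rightarrow> ('a \<Rightarrow>\<^sub>0 'k) \<Rightarrow> ('a \<Rightarrow>\<^sub>0 'k)"
  where "free_scale c f = Poly_Mapping.map ((*) c) f"

definition basis_vec :: "'a \<Rightarrow> ('a \<Rightarrow>\<^sub>0 'k::field)"
  where "basis_vec a = Poly_Mapping.single a 1"

definition lin_span :: "'a set \<Rightarrow> ('a \<Rightarrow>\<^sub>0 'k::field) set"
  where "lin_span B = module.span free_scale (basis_vec ` B)"

definition linear_extension :: "('a \<Rightarrow> 'b) \<Rightarrow> ('a \<Rightarrow>\<^sub>0 'k::field) \<Rightarrow> ('b \<Rightarrow>\<^sub>0 'k)"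
  where "linear_extension h f =
    (\<Sum>a\<in>Poly_Mapping.keys f. free_scale (Poly_Mapping.lookup f a) (basis_vec (h a)))"

definition bilinear_extension ::
  "('a \<Rightarrow> 'a \<Rightarrow> 'b) \<Rightarrow> ('a \<Rightarrow>\<^sub>0 'k::field) \<Rightarrow> ('a \<Rightarrow>\<^sub>0 'k) \<Rightarrow> ('b \<Rightarrow>\<^sub>0 'k)"
  where "bilinear_extension h f g =
    (\<Sum>a\<in>Poly_Mapping.keys f. \<Sum>b\<in>Poly_Mapping.keys g.
      free_scale (Poly_Mapping.lookup f a * Poly_Mapping.lookup g b) (basis_vec (h a b)))"

lemma lookup_free_scale:
  "Poly_Mapping.lookup (free_scale c f) a = c * Poly_Mapping.lookup f a"
  by (simp add: free_scale_def map.rep_eq when_def)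

lemma vector_space_free_scale:
  "vector_space (free_scale :: 'k::field \<Rightarrow> ('a \<Rightarrow>\<^sub>0 'k) \<Rightarrow> ('a \<Rightarrow>\<^sub>0 'k))"
  by unfold_locales
    (auto intro!: poly_mapping_eqI simp: lookup_free_scale lookup_add algebra_simps)


section \<open>The operad of cliques decorated by a unitary magma\<close>

class unitary_magma = times + one +
  assumes unit_times: "1 * a = a"
    and times_unit: "a * 1 = a"

definition arcs :: "nat \<Rightarrow> (nat \<times> nat) set"
  where "arcs n = {(x, y). 1 \<le> x \<and> x < y \<and> y \<le> n + 1}"

text \<open>
  A clique is a pair of its arity \<open>n\<close> and of its labelling, which is \<open>undefined\<close> outside of
  \<open>arcs n\<close>.
\<close>

type_synonym 'm clique = "nat \<times> (nat \<times> nat \<Rightarrow> 'm)"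

definition cliques :: "nat \<Rightarrow> 'm::unitary_magma clique set"
  where "cliques n = {(n, p) | p. p \<in> arcs n \<rightarrow>\<^sub>E UNIV \<and> (n = 1 \<longrightarrow> p (1, 2) = 1)}"

definition unit_clique :: "'m::unitary_magma clique"
  where "unit_clique = (1, \<lambda>a\<in>arcs 1. 1)"

definition clique_comp :: "nat \<Rightarrow> 'm::unitary_magma clique \<Rightarrow> 'm clique \<Rightarrow> 'm clique"
  where "clique_comp i P Q =
    (case (P, Q) of ((n, p), (m, q)) \<Rightarrow>
      (n + m - 1,
       \<lambda>(x, y)\<in>arcs (n + m - 1).
         if y \<le> i then p (x, y)
         else if x \<le> i \<and> i + m \<le> y \<and> (x, y) \<noteq> (i, i + m) then p (x, y - m + 1)
         else if i + m \<le> x then p (x - m + 1, y - m + 1)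
         else if i \<le> x \<and> x < y \<and> y \<le> i + m \<and> (x, y) \<noteq> (i, i + m) then q (x - i + 1, y - i + 1)
         else if (x, y) = (i, i + m) then p (i, i + 1) * q (1, m + 1)
         else 1))"

definition clique_operad :: "('k::field, 'm::unitary_magma clique \<Rightarrow>\<^sub>0 'k) operad_data"
  where "clique_operad =
    \<lparr>scale = free_scale,
     component = (\<lambda>n. lin_span (cliques n)),
     pcomp = (\<lambda>i. bilinear_extension (clique_comp i)),
     op_unit = basis_vec unit_clique\<rparr>"

datatype D0 = D0_unit | D0_zero

instantiation D0 :: "{unitary_magma, zero}"
begin

definition one_D0 :: D0 where "one_D0 = D0_unit"

definition zero_D0 :: D0 where "zero_D0 = D0_zero"

definition times_D0 :: "D0 \<Rightarrow> D0 \<Rightarrow> D0"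
  where "times_D0 a b = (if a = D0_zero \<or> b = D0_zero then D0_zero else D0_unit)"

instance
proof
  fix a :: D0
  show "1 * a = a" "a * 1 = a"
    by (cases a; simp add: one_D0_def times_D0_def)+
qed

end

definition CD0 :: "('k::field, D0 clique \<Rightarrow>\<^sub>0 'k) operad_data"
  where "CD0 = clique_operad"


section \<open>The operad of multi-tildes\<close>

type_synonym multi_tilde = "nat \<times> (nat \<times> nat) set"

definition multi_tildes :: "nat \<Rightarrow> multi_tilde set"
  where "multi_tildes n = {(n, s) | s. s \<subseteq> {(x, y). x \<in> {1..n} \<and> y \<in> {1..n} \<and> x \<le> y}}"

text \<open>
  The condition \<open>y \<le> j - 1\<close>, for integers, is written \<open>y < j\<close> since subtraction truncates on
  natural numbers.
\<close>

definition sh :: "nat \<Rightarrow> nat \<Rightarrow> nat \<times> nat \<Rightarrow> nat \<times> nat"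
  where "sh j p = (\<lambda>(x, y).
    if y < j then (x, y)
    else if x \<le> j \<and> j \<le> y then (x, y + p - 1)
    else (x + p - 1, y + p - 1))"

definition mt_comp :: "nat \<Rightarrow> multi_tilde \<Rightarrow> multi_tilde \<Rightarrow> multi_tilde"
  where "mt_comp i S T =
    (case (S, T) of ((n, s), (m, t)) \<Rightarrow> (n + m - 1, sh i m ` s \<union> sh 0 i ` t))"

definition MT :: "('k::field, multi_tilde \<Rightarrow>\<^sub>0 'k) operad_data"
  where "MT =
    \<lparr>scale = free_scale,
     component = (\<lambda>n. lin_span (multi_tildes n)),
     pcomp = (\<lambda>i. bilinear_extension (mt_comp i)),
     op_unit = basis_vec (1, {})\<rparr>"

definition MT_proper :: "('k::field, multi_tilde \<Rightarrow>\<^sub>0 'k) operad_data"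
  where "MT_proper = MT\<lparr>component := (\<lambda>n. lin_span (multi_tildes n - {(1, {(1, 1)})}))\<rparr>"

definition mt_clique :: "multi_tilde \<Rightarrow> D0 clique"
  where "mt_clique S =
    (case S of (n, s) \<Rightarrow> (n, \<lambda>(x, y)\<in>arcs n. if (x, y - 1) \<in> s then 0 else 1))"

text \<open>
  Being a function on the whole type, \<open>phi_MT\<close> also has a value at the multi-tilde
  \<open>(1, {(1, 1)})\<close>; it is irrelevant, as this element is outside of \<open>MT_proper\<close>.
\<close>

definition phi_MT :: "(multi_tilde \<Rightarrow>\<^sub>0 'k::field) \<Rightarrow> (D0 clique \<Rightarrow>\<^sub>0 'k)"
  where "phi_MT = linear_extension mt_clique"

end

theory Submission
  imports Defs
begin

text \<open>
  All three operads are linear spans of operads in sets: the composition of two basis elements is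
  a basis element. So everything takes place on bases.

  A multi-tilde \<open>s\<close> of arity \<open>n\<close> and a clique with labels \<open>0\<close> and \<open>1\<close> on the arcs of \<open>[n + 1]\<close> carry
  the same information: \<open>(x, y)\<close> belongs to \<open>s\<close> exactly if the arc \<open>(x, y + 1)\<close> is labelled by \<open>0\<close>.
  The set \<open>{(1, 1)}\<close> in arity \<open>1\<close> is excluded since the only arc of a clique of arity \<open>1\<close> must
  have the label \<open>1\<close>. Under this dictionary the two shift maps in the composition of multi-tildes
  place the arcs of the two cliques exactly as in the composition of cliques
  (\<open>mem_sh_image_iff\<close>, \<open>mem_sh_zero_image_iff\<close>). The only arc reached from both sides is
  \<open>(i, i + m)\<close>; there the union of the two sets corresponds to the product of labels, because a
  product in \<open>D0\<close> is \<open>0\<close> exactly if one of its factors is (\<open>mt_clique_comp\<close>).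

  The operad axioms for multi-tildes are identities between composites of shift maps. Those for
  cliques need no separate verification: they are transported along the bijection
  (\<open>image_set_operad\<close>). Linear extension then turns the isomorphism of operads in sets into an
  isomorphism of operads in vector spaces (\<open>ns_operad_linearization\<close>,
  \<open>operad_iso_linearization\<close>).
\<close>

section \<open>Linear and bilinear extensions\<close>

abbreviation free_linear :: "(('a \<Rightarrow>\<^sub>0 'k::field) \<Rightarrow> ('b \<Rightarrow>\<^sub>0 'k)) \<Rightarrow> bool"
  where "free_linear \<equiv> Vector_Spaces.linear free_scale free_scale"

interpretation free: vector_space "free_scale :: 'k::field \<Rightarrow> ('a \<Rightarrow>\<^sub>0 'k) \<Rightarrow> ('a \<Rightarrow>\<^sub>0 'k)"
  by (rule vector_space_free_scale)

interpretation free_pair: vector_space_pair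
  "free_scale :: 'k::field \<Rightarrow> ('a \<Rightarrow>\<^sub>0 'k) \<Rightarrow> ('a \<Rightarrow>\<^sub>0 'k)"
  "free_scale :: 'k::field \<Rightarrow> ('b \<Rightarrow>\<^sub>0 'k) \<Rightarrow> ('b \<Rightarrow>\<^sub>0 'k)"
  by unfold_locales

lemma free_linearI:
  assumes "\<And>x y. f (x + y) = f x + f y"
    and "\<And>c x. f (free_scale c x) = free_scale c (f x)"
  shows "free_linear f"
  using assms by unfold_locales

lemma free_linear_compose:
  assumes "free_linear f" "free_linear g"
  shows "free_linear (\<lambda>x. g (f x))"
  using Vector_Spaces.linear_compose[OF assms] by (simp add: o_def)

lemma free_linear_ident: "free_linear (\<lambda>x. x)"
  by (rule free_linearI) simp_all

lemma free_linear_eq_on_lin_span: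
  assumes "free_linear f" "free_linear g" "x \<in> lin_span B"
    and "\<And>a. a \<in> B \<Longrightarrow> f (basis_vec a) = g (basis_vec a)"
  shows "f x = g x"
  using free_pair.linear_eq_on_span[OF assms(1,2), of "basis_vec ` B" x] assms(3,4)
  by (auto simp: lin_span_def)

lemma subspace_lin_span: "free.subspace (lin_span B)"
  by (simp add: lin_span_def)

lemma basis_vec_in_lin_span: "a \<in> B \<Longrightarrow> basis_vec a \<in> lin_span B"
  by (simp add: lin_span_def free.span_base)

lemma lin_span_mono: "A \<subseteq> B \<Longrightarrow> lin_span A \<subseteq> lin_span B"
  by (simp add: lin_span_def free.span_mono image_mono)

lemma keys_lin_span:
  assumes "x \<in> lin_span B"
  shows "Poly_Mapping.keys x \<subseteq> B"
  using assms unfolding lin_span_def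
proof (induction rule: free.span_induct)
  case base
  show ?case
    by (auto simp: free.subspace_def lookup_free_scale in_keys_iff lookup_add subset_iff) (metis add.right_neutral)
qed (auto simp: basis_vec_def)

lemma linear_extension_superset:
  assumes "finite A" "Poly_Mapping.keys f \<subseteq> A"
  shows "linear_extension h f = (\<Sum>a\<in>A. free_scale (Poly_Mapping.lookup f a) (basis_vec (h a)))"
  unfolding linear_extension_def using assms
  by (intro sum.mono_neutral_left) (auto simp: in_keys_iff)

lemma free_linear_linear_extension: "free_linear (linear_extension (h :: 'a \<Rightarrow> 'b) :: _ \<Rightarrow> _ \<Rightarrow>\<^sub>0 'c::field)"
proof (rule free_linearI)
  fix x y :: "'a \<Rightarrow>\<^sub>0 'c"
  let ?A = "Poly_Mapping.keys x \<union> Poly_Mapping.keys y"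
  show "linear_extension h (x + y) = linear_extension h x + linear_extension h y"
    using keys_add[of x y]
    by (simp add: linear_extension_superset[of ?A] lookup_add free.scale_left_distrib sum.distrib)
next
  fix c :: 'c and x :: "'a \<Rightarrow>\<^sub>0 'c"
  have "Poly_Mapping.keys (free_scale c x) \<subseteq> Poly_Mapping.keys x"
    by (auto simp: in_keys_iff lookup_free_scale)
  then show "linear_extension h (free_scale c x) = free_scale c (linear_extension h x)"
    by (simp add: linear_extension_superset[of "Poly_Mapping.keys x"] lookup_free_scale
        free.scale_sum_right)
qed

lemma linear_extension_basis_vec [simp]:
  "linear_extension h (basis_vec a :: 'a \<Rightarrow>\<^sub>0 'k::field) = basis_vec (h a)"
  by (simp add: linear_extension_def basis_vec_def[of a])

lemma bilinear_extension_left: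
  "bilinear_extension h f g =
    (\<Sum>b\<in>Poly_Mapping.keys g.
      free_scale (Poly_Mapping.lookup g b) (linear_extension (\<lambda>a. h a b) f))"
  unfolding bilinear_extension_def linear_extension_def
  by (subst sum.swap) (simp add: free.scale_sum_right mult.commute)

lemma bilinear_extension_right:
  "bilinear_extension h f g =
    (\<Sum>a\<in>Poly_Mapping.keys f. free_scale (Poly_Mapping.lookup f a) (linear_extension (h a) g))"
  unfolding bilinear_extension_def linear_extension_def
  by (simp add: free.scale_sum_right)

lemma free_linear_bilinear_extension_left: "free_linear (\<lambda>f. bilinear_extension h f g)"
  by (rule free_linearI)
    (simp_all add: bilinear_extension_left sum.distrib free.scale_right_distrib
      free.scale_sum_right mult.commute
      free_pair.linear_add[OF free_linear_linear_extension]
      free_pair.linear_scale[OF free_linear_linear_extension])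

lemma free_linear_bilinear_extension_right: "free_linear (bilinear_extension h f)"
  by (rule free_linearI)
    (simp_all add: bilinear_extension_right sum.distrib free.scale_right_distrib
      free.scale_sum_right mult.commute
      free_pair.linear_add[OF free_linear_linear_extension]
      free_pair.linear_scale[OF free_linear_linear_extension])

lemma bilinear_extension_basis_vec [simp]:
  "bilinear_extension h (basis_vec a) (basis_vec b :: 'b \<Rightarrow>\<^sub>0 'k::field) = basis_vec (h a b)"
  by (simp add: bilinear_extension_right basis_vec_def[of a])

lemma linear_extension_in_lin_span:
  assumes "x \<in> lin_span A" "\<And>a. a \<in> A \<Longrightarrow> h a \<in> B"
  shows "linear_extension h x \<in> lin_span B"
  unfolding linear_extension_def
  using keys_lin_span[OF assms(1)] assms(2)
  by (intro free.subspace_sum[OF subspace_lin_span] free.subspace_scale[OF subspace_lin_span]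
      basis_vec_in_lin_span) auto

lemma bilinear_extension_in_lin_span:
  assumes "x \<in> lin_span A" "y \<in> lin_span B" "\<And>a b. a \<in> A \<Longrightarrow> b \<in> B \<Longrightarrow> h a b \<in> C"
  shows "bilinear_extension h x y \<in> lin_span C"
  unfolding bilinear_extension_def
  using keys_lin_span[OF assms(1)] keys_lin_span[OF assms(2)] assms(3)
  by (intro free.subspace_sum[OF subspace_lin_span] free.subspace_scale[OF subspace_lin_span]
      basis_vec_in_lin_span) auto

section \<open>Nonsymmetric operads in sets and their linearizations\<close>

text \<open>
  A nonsymmetric operad in sets, as a family of components inside a type, with total functions
  for the partial compositions. As for operads in vector spaces, only arities \<open>n \<ge> 1\<close> matter.
  Components of distinct arities are disjoint, which makes their spans independent.
\<close>

locale set_operad =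
  fixes C :: "nat \<Rightarrow> 'a set" and cmp :: "nat \<Rightarrow> 'a \<Rightarrow> 'a \<Rightarrow> 'a" and e :: 'a
  assumes disjoint: "\<lbrakk>n \<ge> 1; m \<ge> 1; a \<in> C n; a \<in> C m\<rbrakk> \<Longrightarrow> n = m"
    and unit_closed: "e \<in> C 1"
    and closed: "\<lbrakk>n \<ge> 1; m \<ge> 1; i \<in> {1..n}; a \<in> C n; b \<in> C m\<rbrakk> \<Longrightarrow> cmp i a b \<in> C (n + m - 1)"
    and assoc_sequential:
      "\<lbrakk>n \<ge> 1; m \<ge> 1; l \<ge> 1; i \<in> {1..n}; j \<in> {1..m}; a \<in> C n; b \<in> C m; c \<in> C l\<rbrakk>
        \<Longrightarrow> cmp (i + j - 1) (cmp i a b) c = cmp i a (cmp j b c)"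
    and assoc_parallel:
      "\<lbrakk>n \<ge> 1; m \<ge> 1; l \<ge> 1; 1 \<le> i; i < j; j \<le> n; a \<in> C n; b \<in> C m; c \<in> C l\<rbrakk>
        \<Longrightarrow> cmp (j + m - 1) (cmp i a b) c = cmp i (cmp j a c) b"
    and unit_left: "\<lbrakk>n \<ge> 1; a \<in> C n\<rbrakk> \<Longrightarrow> cmp 1 e a = a"
    and unit_right: "\<lbrakk>n \<ge> 1; i \<in> {1..n}; a \<in> C n\<rbrakk> \<Longrightarrow> cmp i a e = a"

text \<open>The operad in vector spaces freely spanned by an operad in sets.\<close>

definition linearization ::
  "(nat \<Rightarrow> 'a set) \<Rightarrow> (nat \<Rightarrow> 'a \<Rightarrow> 'a \<Rightarrow> 'a) \<Rightarrow> 'a \<Rightarrow> ('k::field, 'a \<Rightarrow>\<^sub>0 'k) operad_data"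
  where "linearization C cmp e =
    \<lparr>scale = free_scale,
     component = (\<lambda>n. lin_span (C n)),
     pcomp = (\<lambda>i. bilinear_extension (cmp i)),
     op_unit = basis_vec e\<rparr>"

lemma linearization_simps [simp]:
  "scale (linearization C cmp e) = free_scale"
  "component (linearization C cmp e) n = lin_span (C n)"
  "pcomp (linearization C cmp e) i = bilinear_extension (cmp i)"
  "op_unit (linearization C cmp e) = basis_vec e"
  by (simp_all add: linearization_def)

text \<open>
  The associativity axioms equate two expressions that are linear in each of three arguments;
  hence it suffices to verify them on basis elements.
\<close>

lemma trilinear_eq:
  assumes x: "x \<in> lin_span A" and y: "y \<in> lin_span B" and z: "z \<in> lin_span C"
    and lin1: "\<And>y z. free_linear (\<lambda>x. F x y z)" "\<And>y z. free_linear (\<lambda>x. G x y z)"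
    and lin2: "\<And>x z. free_linear (\<lambda>y. F x y z)" "\<And>x z. free_linear (\<lambda>y. G x y z)"
    and lin3: "\<And>x y. free_linear (\<lambda>z. F x y z)" "\<And>x y. free_linear (\<lambda>z. G x y z)"
    and basis: "\<And>a b c. \<lbrakk>a \<in> A; b \<in> B; c \<in> C\<rbrakk> \<Longrightarrow>
      F (basis_vec a) (basis_vec b) (basis_vec c) = G (basis_vec a) (basis_vec b) (basis_vec c)"
  shows "F x y z = G x y z"
proof (rule free_linear_eq_on_lin_span[OF lin1 x])
  fix a assume a: "a \<in> A"
  show "F (basis_vec a) y z = G (basis_vec a) y z"
  proof (rule free_linear_eq_on_lin_span[OF lin2 y])
    fix b assume b: "b \<in> B"
    show "F (basis_vec a) (basis_vec b) z = G (basis_vec a) (basis_vec b) z"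
      by (rule free_linear_eq_on_lin_span[OF lin3 z]) (rule basis[OF a b])
  qed
qed

lemmas free_linear_intros =
  free_linear_linear_extension
  free_linear_bilinear_extension_left free_linear_bilinear_extension_right
  free_linear_compose[OF free_linear_bilinear_extension_left free_linear_bilinear_extension_left]
  free_linear_compose[OF free_linear_bilinear_extension_left free_linear_bilinear_extension_right]
  free_linear_compose[OF free_linear_bilinear_extension_right free_linear_bilinear_extension_left]
  free_linear_compose[OF free_linear_bilinear_extension_right free_linear_bilinear_extension_right]
  free_linear_compose[OF free_linear_bilinear_extension_left free_linear_linear_extension]
  free_linear_compose[OF free_linear_bilinear_extension_right free_linear_linear_extension]
  free_linear_compose[OF free_linear_linear_extension free_linear_bilinear_extension_left]
  free_linear_compose[OF free_linear_linear_extension free_linear_bilinear_extension_right]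

context set_operad
begin

lemma ns_operad_linearization:
  "ns_operad (linearization C cmp e :: ('k::field, 'a \<Rightarrow>\<^sub>0 'k) operad_data)"
proof -
  let ?P = "linearization C cmp e :: ('k, 'a \<Rightarrow>\<^sub>0 'k) operad_data"
  interpret vector_space "scale ?P"
    using vector_space_free_scale by simp
  show ?thesis
  proof (unfold_locales, goal_cases)
    case (1 n)
    then show ?case by (simp add: subspace_lin_span)
  next
    case (2 N v m)
    show ?case
    proof (rule poly_mapping_eqI)
      fix a
      show "Poly_Mapping.lookup (v m) a = Poly_Mapping.lookup 0 a"
      \<comment> \<open>At a basis element of arity \<open>m\<close>, only the summand \<open>v m\<close> can be nonzero.\<close>
      proof (cases "a \<in> C m")
        case True
        have "Poly_Mapping.lookup (v n) a = 0" if "n \<in> N" "n \<noteq> m" for n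
        proof -
          have "a \<notin> C n" using disjoint[of n m a] that 2 True by auto
          then show ?thesis
            using keys_lin_span[of "v n" "C n"] 2(3)[OF that(1)] by (auto simp: in_keys_iff)
        qed
        then have "(\<Sum>n\<in>N. Poly_Mapping.lookup (v n) a) = Poly_Mapping.lookup (v m) a"
          using 2 by (simp add: sum.remove[of N m])
        then show ?thesis
          using arg_cong[OF 2(4), of "\<lambda>x. Poly_Mapping.lookup x a"] by (simp add: lookup_sum)
      next
        case False
        then show ?thesis
          using keys_lin_span[of "v m" "C m"] 2(3)[OF 2(5)] by (auto simp: in_keys_iff)
      qed
    qed
  next
    case 3
    show ?case by (simp add: basis_vec_in_lin_span unit_closed[simplified])
  next
    case (4 n m i x y)
    then show ?case
      unfolding linearization_simps
      by (intro bilinear_extension_in_lin_span[of x "C n" y "C m"] closed)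
  next
    case (5 n m i x x' y)
    show ?case by (simp add: free_pair.linear_add[OF free_linear_bilinear_extension_left])
  next
    case (6 n m i x y c)
    show ?case by (simp add: free_pair.linear_scale[OF free_linear_bilinear_extension_left])
  next
    case (7 n m i x y y')
    show ?case by (simp add: free_pair.linear_add[OF free_linear_bilinear_extension_right])
  next
    case (8 n m i x y c)
    show ?case by (simp add: free_pair.linear_scale[OF free_linear_bilinear_extension_right])
  next
    case (9 n m l i j x y z)
    show ?case unfolding linearization_simps
      by (rule trilinear_eq[of x "C n" y "C m" z "C l"
            "\<lambda>x y z. bilinear_extension (cmp (i + j - 1)) (bilinear_extension (cmp i) x y) z"
            "\<lambda>x y z. bilinear_extension (cmp i) x (bilinear_extension (cmp j) y z)"])
        (use 9 in \<open>auto intro!: free_linear_intros simp: assoc_sequential[of n m l i j, simplified]\<close>)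
  next
    case (10 n m l i j x y z)
    show ?case unfolding linearization_simps
      by (rule trilinear_eq[of x "C n" y "C m" z "C l"
            "\<lambda>x y z. bilinear_extension (cmp (j + m - 1)) (bilinear_extension (cmp i) x y) z"
            "\<lambda>x y z. bilinear_extension (cmp i) (bilinear_extension (cmp j) x z) y"])
        (use 10 in \<open>auto intro!: free_linear_intros simp: assoc_parallel[of n m l i j, simplified]\<close>)
  next
    case (11 n x)
    then show ?case
      using free_linear_eq_on_lin_span[of "bilinear_extension (cmp 1) (basis_vec e)" "\<lambda>x. x" x "C n"]
      by (auto simp: free_linear_ident free_linear_intros unit_left[simplified])
  next
    case (12 n i x)
    then show ?case
      using free_linear_eq_on_lin_span[of "\<lambda>x. bilinear_extension (cmp i) x (basis_vec e)" "\<lambda>x. x" x "C n"]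
      by (auto simp: free_linear_ident free_linear_intros unit_right[simplified])
  qed
qed

lemma set_operad_subset:
  assumes "\<And>n. n \<ge> 1 \<Longrightarrow> C' n \<subseteq> C n" and "e \<in> C' 1"
    and "\<And>n m i a b. \<lbrakk>n \<ge> 1; m \<ge> 1; i \<in> {1..n}; a \<in> C' n; b \<in> C' m\<rbrakk>
      \<Longrightarrow> cmp i a b \<in> C' (n + m - 1)"
  shows "set_operad C' cmp e"
proof (unfold_locales, goal_cases)
  case (1 n m a)
  then show ?case using disjoint[of n m a] assms(1) by blast
next
  case 2
  then show ?case by (rule assms(2))
next
  case (3 n m i a b)
  then show ?case by (rule assms(3))
next
  case (4 n m l i j a b c)
  then show ?case using assms(1) by (intro assoc_sequential[of n m l]; blast)
next
  case (5 n m l i j a b c)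
  then show ?case using assms(1) by (intro assoc_parallel[of n m l]; blast)
next
  case (6 n a)
  then show ?case using assms(1) by (intro unit_left[of n]; blast)
next
  case (7 n i a)
  then show ?case using assms(1) by (intro unit_right[of n]; blast)
qed

end

text \<open>
  An isomorphism \<open>f\<close> from an operad in sets onto a graded set with partial compositions,
  with inverse \<open>g\<close>. That the target is an operad is a consequence.
\<close>

locale set_operad_iso = set_operad C cmp e
  for C :: "nat \<Rightarrow> 'a set" and cmp e +
  fixes D :: "nat \<Rightarrow> 'b set" and cmp' :: "nat \<Rightarrow> 'b \<Rightarrow> 'b \<Rightarrow> 'b" and e' :: 'b
    and f :: "'a \<Rightarrow> 'b" and g :: "'b \<Rightarrow> 'a"
  assumes f_in: "\<lbrakk>n \<ge> 1; a \<in> C n\<rbrakk> \<Longrightarrow> f a \<in> D n"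
    and g_in: "\<lbrakk>n \<ge> 1; b \<in> D n\<rbrakk> \<Longrightarrow> g b \<in> C n"
    and g_f: "\<lbrakk>n \<ge> 1; a \<in> C n\<rbrakk> \<Longrightarrow> g (f a) = a"
    and f_g: "\<lbrakk>n \<ge> 1; b \<in> D n\<rbrakk> \<Longrightarrow> f (g b) = b"
    and f_unit: "f e = e'"
    and f_comp: "\<lbrakk>n \<ge> 1; m \<ge> 1; i \<in> {1..n}; a \<in> C n; a' \<in> C m\<rbrakk>
      \<Longrightarrow> f (cmp i a a') = cmp' i (f a) (f a')"
begin

lemma image_set_operad: "set_operad D cmp' e'"
proof -
  have cmp': "cmp' i b b' = f (cmp i (g b) (g b'))"
    if "n \<ge> 1" "m \<ge> 1" "i \<in> {1..n}" "b \<in> D n" "b' \<in> D m" for n m i b b'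
    using that by (simp add: f_comp[of n m] g_in f_g[of n] f_g[of m])
  have g_comp: "g (cmp' i b b') = cmp i (g b) (g b')"
    if "n \<ge> 1" "m \<ge> 1" "i \<in> {1..n}" "b \<in> D n" "b' \<in> D m" for n m i b b'
    unfolding cmp'[OF that] using that
    by (intro g_f[of "n + m - 1"] closed) (auto intro: g_in)
  have g_unit: "g e' = e"
    using g_f[OF _ unit_closed] f_unit by simp
  have closed': "cmp' i b b' \<in> D (n + m - 1)"
    if "n \<ge> 1" "m \<ge> 1" "i \<in> {1..n}" "b \<in> D n" "b' \<in> D m" for n m i b b'
    unfolding cmp'[OF that] using that by (intro f_in closed) (auto intro: g_in)
  have unit': "e' \<in> D 1"
    using f_in[OF _ unit_closed] f_unit by simp
  \<comment> \<open>An axiom for \<open>D\<close> is checked by applying the injective map \<open>g\<close> to both sides.\<close>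
  have inj: "b = b'" if "n \<ge> 1" "b \<in> D n" "b' \<in> D n" "g b = g b'" for n b b'
    using that f_g by metis
  show ?thesis
  proof (unfold_locales, goal_cases)
    case (1 n m b)
    then show ?case using disjoint[of n m "g b"] g_in by blast
  next
    case 2
    then show ?case by (rule unit')
  next
    case (3 n m i b b')
    then show ?case by (rule closed')
  next
    case (4 n m l i j a b c)
    have lhs: "cmp' i a b \<in> D (n + m - 1)" and rhs: "cmp' j b c \<in> D (m + l - 1)"
      using 4 by (simp_all only: closed')
    have arity: "n + m - 1 + l - 1 = n + (m + l - 1) - 1" and pos: "1 \<le> n + m - 1" "1 \<le> m + l - 1"
      and ij: "i + j - 1 \<in> {1..n + m - 1}"
      using 4 by auto
    show ?case
    proof (rule inj[of "n + (m + l - 1) - 1"])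
      show "cmp' (i + j - 1) (cmp' i a b) c \<in> D (n + (m + l - 1) - 1)"
        using closed'[OF pos(1) 4(3) ij lhs 4(8)] unfolding arity .
      show "cmp' i a (cmp' j b c) \<in> D (n + (m + l - 1) - 1)"
        by (rule closed'[OF 4(1) pos(2) 4(4,6) rhs])
      show "g (cmp' (i + j - 1) (cmp' i a b) c) = g (cmp' i a (cmp' j b c))"
        using 4 g_comp[OF pos(1) 4(3) ij lhs 4(8)] g_comp[OF 4(1) pos(2) 4(4,6) rhs]
        by (simp only: g_comp[OF 4(1,2,4,6,7)] g_comp[OF 4(2,3,5,7,8)]
            assoc_sequential[OF 4(1-5) g_in[OF 4(1,6)] g_in[OF 4(2,7)] g_in[OF 4(3,8)]])
    qed (use 4 in auto)
  next
    case (5 n m l i j a b c)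
    have lhs: "cmp' i a b \<in> D (n + m - 1)" and rhs: "cmp' j a c \<in> D (n + l - 1)"
      using 5 by (auto intro!: closed' simp del: One_nat_def)
    have arity: "n + l - 1 + m - 1 = n + m - 1 + l - 1" and pos: "1 \<le> n + m - 1" "1 \<le> n + l - 1"
      and ij: "j + m - 1 \<in> {1..n + m - 1}" "i \<in> {1..n + l - 1}" "i \<in> {1..n}" "j \<in> {1..n}"
      using 5 by auto
    show ?case
    proof (rule inj[of "n + m - 1 + l - 1"])
      show "cmp' (j + m - 1) (cmp' i a b) c \<in> D (n + m - 1 + l - 1)"
        by (rule closed'[OF pos(1) 5(3) ij(1) lhs 5(9)])
      show "cmp' i (cmp' j a c) b \<in> D (n + m - 1 + l - 1)"
        using closed'[OF pos(2) 5(2) ij(2) rhs 5(8)] unfolding arity .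
      show "g (cmp' (j + m - 1) (cmp' i a b) c) = g (cmp' i (cmp' j a c) b)"
        using 5 g_comp[OF pos(1) 5(3) ij(1) lhs 5(9)] g_comp[OF pos(2) 5(2) ij(2) rhs 5(8)]
        by (simp only: g_comp[OF 5(1,2) ij(3) 5(7,8)] g_comp[OF 5(1,3) ij(4) 5(7,9)]
            assoc_parallel[OF 5(1-6) g_in[OF 5(1,7)] g_in[OF 5(2,8)] g_in[OF 5(3,9)]])
    qed (use 5 in auto)
  next
    case (6 n b)
    have "cmp' 1 e' b = f (cmp 1 e (g b))"
      using cmp'[of 1 n 1 e' b] unit' 6 by (simp add: g_unit)
    then show ?case using 6 by (simp add: unit_left[simplified, of n] g_in f_g[of n])
  next
    case (7 n i b)
    have "cmp' i b e' = f (cmp i (g b) e)"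
      using cmp'[of n 1 i b e'] unit' 7 by (simp add: g_unit)
    then show ?case using 7 unit_right[of n i "g b"] by (simp add: g_in f_g[of n])
  qed
qed

lemma inverse_set_operad_iso: "set_operad_iso D cmp' e' C cmp e g f"
proof -
  interpret D: set_operad D cmp' e'
    by (rule image_set_operad)
  have "g (cmp' i b b') = cmp i (g b) (g b')"
    if "n \<ge> 1" "m \<ge> 1" "i \<in> {1..n}" "b \<in> D n" "b' \<in> D m" for n m i b b'
  proof -
    have "cmp' i b b' = f (cmp i (g b) (g b'))"
      using that by (simp add: f_comp[of n m] g_in f_g[of n] f_g[of m])
    moreover have "cmp i (g b) (g b') \<in> C (n + m - 1)"
      using that by (intro closed g_in)
    ultimately show ?thesis
      using g_f[of "n + m - 1" "cmp i (g b) (g b')"] that(1,2) by simp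
  qed
  moreover have "g e' = e"
    using g_f[OF _ unit_closed] f_unit by simp
  ultimately show ?thesis
    by unfold_locales (auto intro: f_in g_in f_g g_f)
qed

lemma operad_iso_linearization:
  "operad_iso (linearization C cmp e :: ('k::field, 'a \<Rightarrow>\<^sub>0 'k) operad_data)
    (linearization D cmp' e') (linear_extension f)"
proof -
  have inv: "linear_extension g (linear_extension f x) = x" if "n \<ge> 1" "x \<in> lin_span (C n)"
    for n and x :: "'a \<Rightarrow>\<^sub>0 'k"
    by (rule free_linear_eq_on_lin_span[OF free_linear_compose free_linear_ident that(2)])
      (use that in \<open>auto intro: free_linear_linear_extension simp: g_f[of n]\<close>)
  have inv': "linear_extension f (linear_extension g y) = y" if "n \<ge> 1" "y \<in> lin_span (D n)"
    for n and y :: "'b \<Rightarrow>\<^sub>0 'k"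
    by (rule free_linear_eq_on_lin_span[OF free_linear_compose free_linear_ident that(2)])
      (use that in \<open>auto intro: free_linear_linear_extension simp: f_g[of n]\<close>)
  have "linear_extension f (bilinear_extension (cmp i) x y) =
      bilinear_extension (cmp' i) (linear_extension f x) (linear_extension f y)"
    if "n \<ge> 1" "m \<ge> 1" "i \<in> {1..n}" "x \<in> lin_span (C n)" "y \<in> lin_span (C m)"
    for n m i and x y :: "'a \<Rightarrow>\<^sub>0 'k"
  proof (rule free_linear_eq_on_lin_span[OF _ _ that(4)])
    fix a assume a: "a \<in> C n"
    show "linear_extension f (bilinear_extension (cmp i) (basis_vec a) y) =
      bilinear_extension (cmp' i) (linear_extension f (basis_vec a)) (linear_extension f y)"
    proof (rule free_linear_eq_on_lin_span[OF _ _ that(5)])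
      fix b assume b: "b \<in> C m"
      show "linear_extension f (bilinear_extension (cmp i) (basis_vec a) (basis_vec b)) =
        bilinear_extension (cmp' i) (linear_extension f (basis_vec a))
          (linear_extension f (basis_vec b :: 'a \<Rightarrow>\<^sub>0 'k))"
        using that a b by (simp add: f_comp[of n m])
    qed (rule free_linear_intros)+
  qed (rule free_linear_intros)+
  moreover have "linear_extension f x \<in> lin_span (D n)" if "n \<ge> 1" "x \<in> lin_span (C n)"
    for n and x :: "'a \<Rightarrow>\<^sub>0 'k"
    by (rule linear_extension_in_lin_span) (use that f_in in auto)
  moreover have "linear_extension g y \<in> lin_span (C n)" if "n \<ge> 1" "y \<in> lin_span (D n)"
    for n and y :: "'b \<Rightarrow>\<^sub>0 'k"
    by (rule linear_extension_in_lin_span) (use that g_in in auto)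
  moreover have "bij_betw (linear_extension f :: ('a \<Rightarrow>\<^sub>0 'k) \<Rightarrow> _) (lin_span (C n)) (lin_span (D n))"
    if "n \<ge> 1" for n
    by (rule bij_betw_byWitness[where f' = "linear_extension g"])
      (use that inv inv' calculation in auto)
  ultimately show ?thesis
    unfolding operad_iso_def operad_hom_def
    by (auto simp: ns_operad_linearization set_operad.ns_operad_linearization[OF image_set_operad]
        free_pair.linear_add[OF free_linear_linear_extension]
        free_pair.linear_scale[OF free_linear_linear_extension] f_unit)
qed

end

section \<open>Multi-tildes\<close>

text \<open>
  The identities below are the two associativity axioms, read separately on the pairs contributed
  by each of the factors. A pair \<open>(x, y)\<close> with \<open>x \<le> y\<close> lies before, across or after an insertion
  point, and \<open>sh\<close> is a translation in each of these cases.
\<close>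

lemma sh_zero: "1 \<le> x \<Longrightarrow> sh 0 i (x, y) = (x + i - 1, y + i - 1)"
  by (simp add: sh_def)

lemma sh_before: "y < j \<Longrightarrow> sh j p (x, y) = (x, y)"
  by (simp add: sh_def)

lemma sh_across: "\<lbrakk>x \<le> j; j \<le> y\<rbrakk> \<Longrightarrow> sh j p (x, y) = (x, y + p - 1)"
  by (simp add: sh_def)

lemma sh_after: "\<lbrakk>j < x; x \<le> y\<rbrakk> \<Longrightarrow> sh j p (x, y) = (x + p - 1, y + p - 1)"
  by (simp add: sh_def)

lemma sh_sequential_outer:
  assumes "1 \<le> i" "1 \<le> j" "j \<le> m" "1 \<le> l" "x \<le> y"
  shows "sh (i + j - 1) l (sh i m (x, y)) = sh i (m + l - 1) (x, y)"
proof -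
  consider "y < i" | "x \<le> i" "i \<le> y" | "i < x" by linarith
  then show ?thesis
    by cases (use assms in \<open>simp_all add: sh_before sh_across sh_after ac_simps\<close>)
qed

lemma sh_sequential_middle:
  assumes "1 \<le> i" "1 \<le> j" "1 \<le> l" "1 \<le> x" "x \<le> y"
  shows "sh (i + j - 1) l (sh 0 i (x, y)) = sh 0 i (sh j l (x, y))"
proof -
  consider "y < j" | "x \<le> j" "j \<le> y" | "j < x" by linarith
  then show ?thesis
    by cases (use assms in \<open>simp_all add: sh_before sh_across sh_after ac_simps\<close>)
qed

lemma sh_sequential_inner:
  "\<lbrakk>1 \<le> i; 1 \<le> j; 1 \<le> x; x \<le> y\<rbrakk> \<Longrightarrow> sh 0 (i + j - 1) (x, y) = sh 0 i (sh 0 j (x, y))"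
  by (simp add: sh_zero ac_simps)

lemma sh_parallel_outer:
  assumes "i < j" "1 \<le> m" "1 \<le> l" "x \<le> y"
  shows "sh (j + m - 1) l (sh i m (x, y)) = sh i m (sh j l (x, y))"
proof -
  consider "y < i" | "x \<le> i" "i \<le> y" "y < j" | "x \<le> i" "j \<le> y"
    | "i < x" "y < j" | "i < x" "x \<le> j" "j \<le> y" | "j < x" by linarith
  then show ?thesis
    by cases (use assms in \<open>simp_all add: sh_before sh_across sh_after ac_simps\<close>)
qed

lemma sh_parallel_left:
  "\<lbrakk>i < j; 1 \<le> x; x \<le> y; y \<le> m\<rbrakk> \<Longrightarrow> sh (j + m - 1) l (sh 0 i (x, y)) = sh 0 i (x, y)"
  by (simp add: sh_zero sh_before)

lemma sh_parallel_right:
  "\<lbrakk>i < j; 1 \<le> m; 1 \<le> x; x \<le> y\<rbrakk> \<Longrightarrow> sh 0 (j + m - 1) (x, y) = sh i m (sh 0 j (x, y))"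
  by (simp add: sh_zero sh_after ac_simps)

lemma multi_tildes_iff:
  "(k, s) \<in> multi_tildes n \<longleftrightarrow> k = n \<and> (\<forall>(x, y)\<in>s. 1 \<le> x \<and> x \<le> y \<and> y \<le> n)"
  by (auto simp: multi_tildes_def)

text \<open>
  Membership in the image of the outer multi-tilde of a composition. The three disjuncts are the
  pairs coming from before, across and after the insertion point.
\<close>

lemma mem_sh_image_iff:
  assumes "1 \<le> m" "(n, s) \<in> multi_tildes n"
  shows "(x, v) \<in> sh i m ` s \<longleftrightarrow>
    v < i \<and> (x, v) \<in> s \<or>
    x \<le> i \<and> i + m \<le> v + 1 \<and> (x, v + 1 - m) \<in> s \<or>
    i + m \<le> x \<and> x \<le> v \<and> (x + 1 - m, v + 1 - m) \<in> s"
    (is "?L \<longleftrightarrow> ?R")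
proof
  assume ?L
  then obtain a b where ab: "(a, b) \<in> s" "(x, v) = sh i m (a, b)" by auto
  then have "a \<le> b" using assms by (auto simp: multi_tildes_iff)
  consider "b < i" | "a \<le> i" "i \<le> b" | "i < a" by linarith
  then show ?R
    by cases (use ab \<open>a \<le> b\<close> assms(1) in \<open>auto simp: sh_before sh_across sh_after\<close>)
next
  have 1: "(x, v) = sh i m (x, v)" if "v < i"
    using that by (simp add: sh_before)
  have 2: "(x, v) = sh i m (x, v + 1 - m)" if "x \<le> i" "i + m \<le> v + 1"
    using that assms(1) by (subst sh_across) auto
  have 3: "(x, v) = sh i m (x + 1 - m, v + 1 - m)" if "i + m \<le> x" "x \<le> v"
    using that assms(1) by (subst sh_after) auto
  assume ?R
  then show ?L
    by (elim disjE conjE) (use 1 2 3 in \<open>blast intro: image_eqI\<close>)+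
qed

lemma mem_sh_zero_image_iff:
  assumes "1 \<le> i" "(m, t) \<in> multi_tildes m"
  shows "(x, v) \<in> sh 0 i ` t \<longleftrightarrow> i \<le> x \<and> x \<le> v \<and> (x + 1 - i, v + 1 - i) \<in> t"
    (is "?L \<longleftrightarrow> ?R")
proof
  assume ?L
  then obtain a b where ab: "(a, b) \<in> t" "(x, v) = sh 0 i (a, b)" by auto
  then have "1 \<le> a" "a \<le> b" using assms by (auto simp: multi_tildes_iff)
  then show ?R using ab assms(1) by (auto simp: sh_zero)
next
  assume ?R
  moreover have "(x, v) = sh 0 i (x + 1 - i, v + 1 - i)" if "i \<le> x" "x \<le> v"
    using that assms(1) by (simp add: sh_zero)
  ultimately show ?L by (blast intro: image_eqI)
qed

lemma mt_comp_closed: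
  assumes "1 \<le> m" "i \<in> {1..n}" "(n, s) \<in> multi_tildes n" "(m, t) \<in> multi_tildes m"
  shows "mt_comp i (n, s) (m, t) \<in> multi_tildes (n + m - 1)"
proof -
  have s: "1 \<le> x \<and> x \<le> y \<and> y \<le> n" if "(x, y) \<in> s" for x y
    using that assms by (auto simp: multi_tildes_iff)
  have t: "1 \<le> x \<and> x \<le> y \<and> y \<le> m" if "(x, y) \<in> t" for x y
    using that assms by (auto simp: multi_tildes_iff)
  have "1 \<le> x \<and> x \<le> v \<and> v \<le> n + m - 1" if mem: "(x, v) \<in> sh i m ` s \<union> sh 0 i ` t" for x v
  proof -
    consider "v < i" "(x, v) \<in> s" | "x \<le> i" "i + m \<le> v + 1" "(x, v + 1 - m) \<in> s"
      | "i + m \<le> x" "x \<le> v" "(x + 1 - m, v + 1 - m) \<in> s"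
      | "i \<le> x" "x \<le> v" "(x + 1 - i, v + 1 - i) \<in> t"
      using mem assms(2)
      by (auto simp: mem_sh_image_iff[OF assms(1,3)] mem_sh_zero_image_iff[OF _ assms(4)])
    then show ?thesis
      by cases (use assms(1,2) in \<open>auto dest: s t\<close>)
  qed
  then have "\<forall>(x, v)\<in>sh i m ` s \<union> sh 0 i ` t. 1 \<le> x \<and> x \<le> v \<and> v \<le> n + m - 1"
    by blast
  then show ?thesis
    by (simp only: mt_comp_def multi_tildes_iff prod.case simp_thms)
qed

lemma multi_tildes_set_operad: "set_operad multi_tildes mt_comp (1, {})"
proof (unfold_locales, goal_cases)
  case (1 n m a)
  then show ?case by (auto simp: multi_tildes_def)
next
  case 2
  then show ?case by (simp add: multi_tildes_iff)
next
  case (3 n m i a b)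
  then show ?case
    by (cases a; cases b) (use mt_comp_closed in \<open>auto simp: multi_tildes_iff\<close>)
next
  case (4 n m l i j a b c)
  obtain s t u where abc: "a = (n, s)" "b = (m, t)" "c = (l, u)"
    using 4 by (auto simp: multi_tildes_def)
  have bounds: "\<And>x y. (x, y) \<in> s \<Longrightarrow> 1 \<le> x \<and> x \<le> y \<and> y \<le> n"
    "\<And>x y. (x, y) \<in> t \<Longrightarrow> 1 \<le> x \<and> x \<le> y \<and> y \<le> m"
    "\<And>x y. (x, y) \<in> u \<Longrightarrow> 1 \<le> x \<and> x \<le> y \<and> y \<le> l"
    using 4 abc by (auto simp: multi_tildes_iff)
  have "sh (i + j - 1) l ` sh i m ` s = sh i (m + l - 1) ` s"
    unfolding image_image by (rule image_cong[OF refl], clarify, rule sh_sequential_outer)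
      (use 4 bounds in auto)
  moreover have "sh (i + j - 1) l ` sh 0 i ` t = sh 0 i ` sh j l ` t"
    unfolding image_image by (rule image_cong[OF refl], clarify, rule sh_sequential_middle)
      (use 4 bounds in auto)
  moreover have "sh 0 (i + j - 1) ` u = sh 0 i ` sh 0 j ` u"
    unfolding image_image by (rule image_cong[OF refl], clarify, rule sh_sequential_inner)
      (use 4 bounds in auto)
  ultimately show ?case
    using 4 by (auto simp: abc mt_comp_def image_Un)
next
  case (5 n m l i j a b c)
  obtain s t u where abc: "a = (n, s)" "b = (m, t)" "c = (l, u)"
    using 5 by (auto simp: multi_tildes_def)
  have bounds: "\<And>x y. (x, y) \<in> s \<Longrightarrow> 1 \<le> x \<and> x \<le> y \<and> y \<le> n"
    "\<And>x y. (x, y) \<in> t \<Longrightarrow> 1 \<le> x \<and> x \<le> y \<and> y \<le> m"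
    "\<And>x y. (x, y) \<in> u \<Longrightarrow> 1 \<le> x \<and> x \<le> y \<and> y \<le> l"
    using 5 abc by (auto simp: multi_tildes_iff)
  have "sh (j + m - 1) l ` sh i m ` s = sh i m ` sh j l ` s"
    unfolding image_image by (rule image_cong[OF refl], clarify, rule sh_parallel_outer)
      (use 5 bounds in auto)
  moreover have "sh (j + m - 1) l ` sh 0 i ` t = sh 0 i ` t"
    unfolding image_image by (rule image_cong[OF refl], clarify, rule sh_parallel_left)
      (use 5 bounds in auto)
  moreover have "sh 0 (j + m - 1) ` u = sh i m ` sh 0 j ` u"
    unfolding image_image by (rule image_cong[OF refl], clarify, rule sh_parallel_right)
      (use 5 bounds in auto)
  ultimately show ?case
    using 5 by (auto simp: abc mt_comp_def image_Un)
next
  case (6 n a)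
  obtain s where a: "a = (n, s)"
    using 6 by (auto simp: multi_tildes_def)
  have "sh 0 1 ` s = id ` s"
    by (rule image_cong) (use 6 a in \<open>auto simp: multi_tildes_iff sh_def\<close>)
  then show ?case by (simp add: a mt_comp_def)
next
  case (7 n i a)
  obtain s where a: "a = (n, s)"
    using 7 by (auto simp: multi_tildes_def)
  have "sh i 1 ` s = id ` s"
    by (rule image_cong) (use 7 a in \<open>auto simp: multi_tildes_iff sh_def\<close>)
  then show ?case by (simp add: a mt_comp_def)
qed

text \<open>All multi-tildes of arity \<open>n\<close> except the nontrivial one of arity \<open>1\<close>.\<close>

definition proper_multi_tildes :: "nat \<Rightarrow> multi_tilde set"
  where "proper_multi_tildes n = multi_tildes n - {(1, {(1, 1)})}"

lemma proper_multi_tildes_iff: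
  "(k, s) \<in> proper_multi_tildes n \<longleftrightarrow> (k, s) \<in> multi_tildes n \<and> (n = 1 \<longrightarrow> s = {})"
proof (cases "(k, s) \<in> multi_tildes n")
  case True
  then have k: "k = n" and bounds: "\<And>x y. (x, y) \<in> s \<Longrightarrow> 1 \<le> x \<and> x \<le> y \<and> y \<le> n"
    by (auto simp: multi_tildes_iff)
  have "s = {} \<or> s = {(1, 1)}" if "n = 1"
  proof -
    have "a = (1, 1)" if "a \<in> s" for a
      using bounds[of "fst a" "snd a"] \<open>n = 1\<close> that by (simp add: prod_eq_iff)
    then show ?thesis by blast
  qed
  then show ?thesis
    using True k by (cases "n = 1") (simp_all add: proper_multi_tildes_def, blast)
next
  case False
  then show ?thesis by (simp add: proper_multi_tildes_def)
qed

lemma proper_multi_tildes_set_operad: "set_operad proper_multi_tildes mt_comp (1, {})"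
proof (rule set_operad.set_operad_subset[OF multi_tildes_set_operad])
  show "(1, {}) \<in> proper_multi_tildes 1"
    by (simp add: proper_multi_tildes_iff multi_tildes_iff)
next
  fix n m i a b
  assume *: "1 \<le> n" "1 \<le> m" "i \<in> {1..n}" "a \<in> proper_multi_tildes n" "b \<in> proper_multi_tildes m"
  then obtain s t where ab: "a = (n, s)" "b = (m, t)"
    by (auto simp: proper_multi_tildes_def multi_tildes_def)
  have closed: "mt_comp i a b \<in> multi_tildes (n + m - 1)"
    unfolding ab using * by (intro mt_comp_closed) (simp_all add: ab proper_multi_tildes_iff)
  have "sh i m ` s \<union> sh 0 i ` t = {}" if "n + m - 1 = 1"
  proof -
    have "n = 1" "m = 1" using that * by auto
    then show ?thesis using * by (simp add: ab proper_multi_tildes_iff)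
  qed
  then show "mt_comp i a b \<in> proper_multi_tildes (n + m - 1)"
    using closed by (simp only: ab mt_comp_def prod.case proper_multi_tildes_iff) blast
qed (auto simp: proper_multi_tildes_def)

section \<open>Multi-tildes as cliques\<close>

text \<open>The inverse of \<open>mt_clique\<close>: the pairs recorded by the arcs with label \<open>0\<close>.\<close>

definition clique_mt :: "D0 clique \<Rightarrow> multi_tilde"
  where "clique_mt P = (case P of (n, p) \<Rightarrow> (n, {(x, y). (x, y + 1) \<in> arcs n \<and> p (x, y + 1) = 0}))"

lemma D0_cases_01: "(a :: D0) = 0 \<or> a = 1"
  by (cases a) (simp_all add: zero_D0_def one_D0_def)

lemma D0_zero_neq_one [simp]: "(0 :: D0) \<noteq> 1" "(1 :: D0) \<noteq> 0"
  by (simp_all add: zero_D0_def one_D0_def)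

lemma D0_times_eq_0_iff [simp]: "(a :: D0) * b = 0 \<longleftrightarrow> a = 0 \<or> b = 0"
  by (simp add: zero_D0_def times_D0_def)

lemma D0_eqI: "(a = 0 \<longleftrightarrow> b = 0) \<Longrightarrow> (a :: D0) = b"
  using D0_cases_01 by metis

lemma mt_clique_comp:
  assumes "1 \<le> n" "1 \<le> m" "i \<in> {1..n}" "(n, s) \<in> multi_tildes n" "(m, t) \<in> multi_tildes m"
  shows "mt_clique (mt_comp i (n, s) (m, t)) = clique_comp i (mt_clique (n, s)) (mt_clique (m, t))"
proof -
  let ?P = "mt_clique (mt_comp i (n, s) (m, t))"
    and ?Q = "clique_comp i (mt_clique (n, s)) (mt_clique (m, t))"
  have arity: "fst ?P = n + m - 1" "fst ?Q = n + m - 1"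
    by (simp_all add: mt_clique_def mt_comp_def clique_comp_def)
  have bounds: "\<And>a b. (a, b) \<in> s \<Longrightarrow> 1 \<le> a \<and> a \<le> b \<and> b \<le> n"
    "\<And>a b. (a, b) \<in> t \<Longrightarrow> 1 \<le> a \<and> a \<le> b \<and> b \<le> m"
    using assms by (auto simp: multi_tildes_iff)
  have label: "snd ?P (x, y) = snd ?Q (x, y)" for x y
  proof (cases "(x, y) \<in> arcs (n + m - 1)")
    case False
    then show ?thesis by (simp add: mt_clique_def mt_comp_def clique_comp_def)
  next
    case True
    then have xy: "1 \<le> x" "x < y" "y \<le> n + m"
      using assms by (auto simp: arcs_def)
    have y: "y - 1 + 1 = y" "x \<le> y - 1" "y - 1 < i \<longleftrightarrow> y \<le> i" using xy by auto
    have P: "snd ?P (x, y) = 0 \<longleftrightarrow>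
      y \<le> i \<and> (x, y - 1) \<in> s \<or> x \<le> i \<and> i + m \<le> y \<and> (x, y - m) \<in> s \<or>
      i + m \<le> x \<and> (x + 1 - m, y - m) \<in> s \<or> i \<le> x \<and> (x + 1 - i, y - i) \<in> t"
      using True assms(3) y
      by (simp add: mt_clique_def mt_comp_def mem_sh_image_iff[OF assms(2,4)]
          mem_sh_zero_image_iff[OF _ assms(5)])
    have Q: "snd ?Q (x, y) =
      (if y \<le> i then snd (mt_clique (n, s)) (x, y)
       else if x \<le> i \<and> i + m \<le> y \<and> (x, y) \<noteq> (i, i + m) then snd (mt_clique (n, s)) (x, y - m + 1)
       else if i + m \<le> x then snd (mt_clique (n, s)) (x - m + 1, y - m + 1)
       else if i \<le> x \<and> x < y \<and> y \<le> i + m \<and> (x, y) \<noteq> (i, i + m)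
         then snd (mt_clique (m, t)) (x - i + 1, y - i + 1)
       else if (x, y) = (i, i + m)
         then snd (mt_clique (n, s)) (i, i + 1) * snd (mt_clique (m, t)) (1, m + 1)
       else 1)"
      using True
      by (simp only: clique_comp_def mt_clique_def prod.case fst_conv snd_conv restrict_apply if_True)
    have zero: "snd (mt_clique (k, r)) (a, b) = 0 \<longleftrightarrow> (a, b - 1) \<in> r"
      if "1 \<le> a" "a < b" "b \<le> k + 1" for k r a b
      using that by (simp add: mt_clique_def arcs_def)
    \<comment> \<open>The first five regions are the first five clauses in the definition of \<open>clique_comp\<close>. The
      last two are the arcs with exactly one end strictly between \<open>i\<close> and \<open>i + m\<close> and the other
      beyond that interval: they cross into the inserted clique and are labelled by the unit.\<close>
    have "y \<le> i \<or> x \<le> i \<and> i + m \<le> y \<and> (x \<noteq> i \<or> y \<noteq> i + m) \<or> i + m \<le> x \<or>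
      i \<le> x \<and> y \<le> i + m \<and> i < y \<and> (x \<noteq> i \<or> y \<noteq> i + m) \<or> x = i \<and> y = i + m \<or>
      x < i \<and> i < y \<and> y < i + m \<or> i < x \<and> x < i + m \<and> i + m < y"
      by linarith
    then consider "y \<le> i" | "x \<le> i" "i + m \<le> y" "x \<noteq> i \<or> y \<noteq> i + m" | "i + m \<le> x"
      | "i \<le> x" "y \<le> i + m" "i < y" "x \<noteq> i \<or> y \<noteq> i + m" | "x = i" "y = i + m"
      | "x < i" "i < y" "y < i + m" | "i < x" "x < i + m" "i + m < y"
      by blast
    then have "snd ?P (x, y) = 0 \<longleftrightarrow> snd ?Q (x, y) = 0"
    proof cases
      case 1
      then have "snd ?Q (x, y) = snd (mt_clique (n, s)) (x, y)" by (simp add: Q)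
      moreover have "\<not> i + m \<le> y" "\<not> i + m \<le> x" "\<not> i \<le> x"
        using 1 xy assms by auto
      ultimately show ?thesis unfolding P using 1 xy assms(3) by (simp add: zero)
    next
      case 2
      then have "snd ?Q (x, y) = snd (mt_clique (n, s)) (x, y - m + 1)"
        using assms(2) by (auto simp: Q)
      moreover have "(x + 1 - i, y - i) \<notin> t" if "i \<le> x"
        using bounds(2)[of "x + 1 - i" "y - i"] 2 that by auto
      ultimately show ?thesis unfolding P using 2 xy assms(2,3) by (auto simp: zero)
    next
      case 3
      then have "snd ?Q (x, y) = snd (mt_clique (n, s)) (x - m + 1, y - m + 1)"
        using assms(2) xy by (simp add: Q)
      moreover have "(x + 1 - i, y - i) \<notin> t"
        using bounds(2)[of "x + 1 - i" "y - i"] 3 xy by auto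
      moreover have "\<not> y \<le> i" "\<not> x \<le> i" "x + 1 - m = x - m + 1"
        using 3 xy assms(2) by auto
      ultimately show ?thesis unfolding P using 3 xy assms(2,3) by (simp add: zero)
    next
      case 4
      then have "snd ?Q (x, y) = snd (mt_clique (m, t)) (x - i + 1, y - i + 1)"
        using xy by (auto simp: Q)
      moreover have "x + 1 - i = x - i + 1" "\<not> y \<le> i" "\<not> (x \<le> i \<and> i + m \<le> y)" "\<not> i + m \<le> x"
        using 4 xy by auto
      ultimately show ?thesis unfolding P using 4 xy assms(2,3) by (auto simp: zero)
    next
      case 5
      then have "snd ?Q (x, y) = snd (mt_clique (n, s)) (i, i + 1) * snd (mt_clique (m, t)) (1, m + 1)"
        unfolding Q using assms(2) by simp
      then show ?thesis unfolding P using 5 assms(1-3) by (simp add: zero)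
    next
      case 6
      then show ?thesis unfolding P by (simp add: Q)
    next
      case 7
      then have "(x + 1 - i, y - i) \<notin> t"
        using bounds(2)[of "x + 1 - i" "y - i"] by auto
      then show ?thesis unfolding P using 7 by (simp add: Q)
    qed
    then show ?thesis by (rule D0_eqI)
  qed
  show ?thesis
    by (rule prod_eqI) (use arity label in auto)
qed

lemma mt_clique_set_operad_iso:
  "set_operad_iso proper_multi_tildes mt_comp (1, {}) cliques clique_comp unit_clique
    mt_clique clique_mt"
proof -
  interpret set_operad proper_multi_tildes mt_comp "(1, {})"
    by (rule proper_multi_tildes_set_operad)
  show ?thesis
  proof (unfold_locales, goal_cases)
    case (1 n a)
    then obtain s where a: "a = (n, s)" and s: "n = 1 \<Longrightarrow> s = {}"
      by (cases a) (auto simp: proper_multi_tildes_iff multi_tildes_iff)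
    have "snd (mt_clique a) \<in> arcs n \<rightarrow>\<^sub>E UNIV"
      by (simp add: a mt_clique_def)
    moreover have "snd (mt_clique a) (1, 2) = 1" if "n = 1"
      using s[OF that] that by (simp add: a mt_clique_def arcs_def)
    moreover have "mt_clique a = (n, snd (mt_clique a))"
      by (simp add: a mt_clique_def)
    ultimately show ?case
      unfolding cliques_def by blast
  next
    case (2 n b)
    then obtain p where b: "b = (n, p)" and p: "n = 1 \<Longrightarrow> p (1, 2) = 1"
      by (auto simp: cliques_def)
    let ?s = "{(x, y). (x, y + 1) \<in> arcs n \<and> p (x, y + 1) = 0}"
    have "(n, ?s) \<in> multi_tildes n"
      by (auto simp: multi_tildes_iff arcs_def)
    moreover have "?s = {}" if "n = 1"
    proof -
      have "arcs n = {(1, 2)}" using that by (auto simp: arcs_def)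
      then show ?thesis using p[OF that] by (auto simp: numeral_2_eq_2)
    qed
    ultimately show ?case
      unfolding b clique_mt_def prod.case proper_multi_tildes_iff by blast
  next
    case (3 n a)
    then obtain s where a: "a = (n, s)"
      and bounds: "\<And>x y. (x, y) \<in> s \<Longrightarrow> 1 \<le> x \<and> x \<le> y \<and> y \<le> n"
      by (cases a) (auto simp: proper_multi_tildes_iff multi_tildes_iff)
    have "(x, y + 1) \<in> arcs n" if "(x, y) \<in> s" for x y
      using bounds[OF that] by (simp add: arcs_def)
    then have "{(x, y). (x, y + 1) \<in> arcs n \<and> snd (mt_clique a) (x, y + 1) = 0} = s"
      by (auto simp: a mt_clique_def split: if_splits)
    then show ?case
      by (simp add: a mt_clique_def clique_mt_def)
  next
    case (4 n b)
    then obtain p where b: "b = (n, p)" and p: "p \<in> arcs n \<rightarrow>\<^sub>E UNIV"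
      by (auto simp: cliques_def)
    have "snd (mt_clique (clique_mt (n, p))) a = p a" for a
    proof (cases "a \<in> arcs n")
      case True
      then show ?thesis
        using D0_cases_01[of "p a"]
        by (cases a) (auto simp: mt_clique_def clique_mt_def arcs_def)
    next
      case False
      then show ?thesis
        using p by (auto simp: mt_clique_def clique_mt_def)
    qed
    then have "snd (mt_clique (clique_mt b)) = snd b"
      unfolding b by auto
    moreover have "fst (mt_clique (clique_mt b)) = fst b"
      by (simp add: b mt_clique_def clique_mt_def)
    ultimately show ?case
      by (simp add: prod_eq_iff)
  next
    case 5
    show ?case by (auto simp: mt_clique_def unit_clique_def)
  next
    case (6 n m i a b)
    then have ab: "a = (n, snd a)" "b = (m, snd b)" "(n, snd a) \<in> multi_tildes n"
      "(m, snd b) \<in> multi_tildes m"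
      by (auto simp: proper_multi_tildes_def multi_tildes_def)
    show ?case
      using mt_clique_comp[OF 6(1-3) ab(3,4)] unfolding ab(1,2)[symmetric] .
  qed
qed

theorem proposition4p1p1:
  shows "suboperad (MT_proper :: ('k::field_char_0, multi_tilde \<Rightarrow>\<^sub>0 'k) operad_data) MT
    \<and> operad_isomorphic (CD0 :: ('k, D0 clique \<Rightarrow>\<^sub>0 'k) operad_data)
        (MT_proper :: ('k, multi_tilde \<Rightarrow>\<^sub>0 'k) operad_data)
    \<and> operad_iso (MT_proper :: ('k, multi_tilde \<Rightarrow>\<^sub>0 'k) operad_data)
        (CD0 :: ('k, D0 clique \<Rightarrow>\<^sub>0 'k) operad_data) phi_MT"
proof -
  have MT: "(MT :: ('k, multi_tilde \<Rightarrow>\<^sub>0 'k) operad_data) = linearization multi_tildes mt_comp (1, {})"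
    by (simp add: MT_def linearization_def)
  have MT_proper: "(MT_proper :: ('k, multi_tilde \<Rightarrow>\<^sub>0 'k) operad_data) =
      linearization proper_multi_tildes mt_comp (1, {})"
    by (simp add: MT_proper_def MT_def linearization_def proper_multi_tildes_def)
  have CD0: "(CD0 :: ('k, D0 clique \<Rightarrow>\<^sub>0 'k) operad_data) =
      linearization cliques clique_comp unit_clique"
    by (simp add: CD0_def clique_operad_def linearization_def)
  have "suboperad (MT_proper :: ('k, multi_tilde \<Rightarrow>\<^sub>0 'k) operad_data) MT"
    unfolding suboperad_def MT MT_proper linearization_simps
    by (intro conjI allI impI refl lin_span_mono
        set_operad.ns_operad_linearization[OF multi_tildes_set_operad]
        set_operad.ns_operad_linearization[OF proper_multi_tildes_set_operad])
      (simp add: proper_multi_tildes_def)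
  moreover have "operad_iso (MT_proper :: ('k, multi_tilde \<Rightarrow>\<^sub>0 'k) operad_data) CD0 phi_MT"
    unfolding MT_proper CD0 phi_MT_def
    by (rule set_operad_iso.operad_iso_linearization[OF mt_clique_set_operad_iso])
  moreover have "operad_isomorphic (CD0 :: ('k, D0 clique \<Rightarrow>\<^sub>0 'k) operad_data) MT_proper"
    unfolding operad_isomorphic_def MT_proper CD0
    by (rule exI, rule set_operad_iso.operad_iso_linearization,
        rule set_operad_iso.inverse_set_operad_iso, rule mt_clique_set_operad_iso)
  ultimately show ?thesis by (intro conjI)
qed

end
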